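(* Let $A$ be a non-empty subset of a group $G$, and let $X_A=\bigcup_{g\in G}K_{gA}\subseteq\beta G$, which is a locally compact co-compact $G$-space. Then $\mathrm{T}(G,X_A,e)=[A]$.
   Context: $G$ is a discrete group with neutral element $e$. $\beta G$ is the Stone–Čech compactification of the discrete space $G$, with the $G$-action extending left multiplication. For $B\subseteq G$, $K_B$ is the closure of $B$ in $\beta G$. $X_A$ is open and $G$-invariant in $\beta G$ and contains $G=G.e$ as a dense orbit. A $G$-space $X$ is co-compact if there is a compact $K\subseteq X$ with $\bigcup_{g\in G}g.K=X$. For non-empty $A,B\subseteq G$ write $A\propto B$ if $A\subseteq FB=\bigcup_{g\in F}gB$ for some finite $F\subseteq G$, and $A\approx B$ if $A\propto B$ and $B\propto A$; $[A]$ is the $\approx$-class of $A$. Type: a pointed locally compact $G$-space is a pair $(X,x_0)$ of a locally compact Hausdorff space $X$ with a $G$-action by homeomorphisms and a point $x_0\in X$ with $G.x_0$ dense. Put $\mathcal M(G,X,x_0)=\{B\subseteq G:\overline{B.x_0}\text{ (closure in }X)\text{ is compact}\}$ and $\mathcal M_A=\{B\subseteq G: B\subseteq FA\text{ for some finite }F\subseteq G\}$. If $X$ is co-compact, there is a non-empty $A\subseteq G$, unique up to $\approx$, with $\mathcal M(G,X,x_0)=\mathcal M_A$, and the type is $\mathrm{T}(G,X,x_0)=[A]$. *)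

theory Defs
  imports "HOL-Analysis.Abstract_Topological_Spaces" "HOL-Algebra.Group_Action"
begin

section \<open>Comparing subsets of a group\<close>

definition translates :: "('g, 'm) monoid_scheme \<Rightarrow> 'g set \<Rightarrow> 'g set \<Rightarrow> 'g set" where
  "translates G F B = (\<Union>g\<in>F. g <#\<^bsub>G\<^esub> B)"

definition set_propto :: "('g, 'm) monoid_scheme \<Rightarrow> 'g set \<Rightarrow> 'g set \<Rightarrow> bool" where
  "set_propto G A B \<longleftrightarrow> (\<exists>F. finite F \<and> F \<subseteq> carrier G \<and> A \<subseteq> translates G F B)"

definition set_approx :: "('g, 'm) monoid_scheme \<Rightarrow> 'g set \<Rightarrow> 'g set \<Rightarrow> bool" where
  "set_approx G A B \<longleftrightarrow> set_propto G A B \<and> set_propto G B A"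

definition approx_class :: "('g, 'm) monoid_scheme \<Rightarrow> 'g set \<Rightarrow> 'g set set" where
  "approx_class G A = {B. B \<subseteq> carrier G \<and> B \<noteq> {} \<and> set_approx G A B}"


section \<open>Pointed locally compact spaces with a group action, and their type\<close>

text \<open>
  The group is discrete, so an action by homeomorphisms is an abstract action in which every
  group element acts as a homeomorphism.  The predicate \<^const>\<open>group_action\<close> requires the maps
  \<open>\<phi> g\<close> to be extensional on the space.
\<close>

definition pointed_lc_gspace ::
    "('g, 'm) monoid_scheme \<Rightarrow> 'x topology \<Rightarrow> ('g \<Rightarrow> 'x \<Rightarrow> 'x) \<Rightarrow> 'x \<Rightarrow> bool" where
  "pointed_lc_gspace G X \<phi> x\<^sub>0 \<longleftrightarrow>
     locally_compact_space X \<and> Hausdorff_space X \<and>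
     group_action G (topspace X) \<phi> \<and>
     (\<forall>g\<in>carrier G. homeomorphic_map X X (\<phi> g)) \<and>
     x\<^sub>0 \<in> topspace X \<and>
     X closure_of (orbit G \<phi> x\<^sub>0) = topspace X"

definition cocompact_gspace ::
    "('g, 'm) monoid_scheme \<Rightarrow> 'x topology \<Rightarrow> ('g \<Rightarrow> 'x \<Rightarrow> 'x) \<Rightarrow> bool" where
  "cocompact_gspace G X \<phi> \<longleftrightarrow>
     (\<exists>K. compactin X K \<and> (\<Union>g\<in>carrier G. \<phi> g ` K) = topspace X)"

definition rel_compact_sets ::
    "('g, 'm) monoid_scheme \<Rightarrow> 'x topology \<Rightarrow> ('g \<Rightarrow> 'x \<Rightarrow> 'x) \<Rightarrow> 'x \<Rightarrow> 'g set set" where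
  "rel_compact_sets G X \<phi> x\<^sub>0 =
     {B. B \<subseteq> carrier G \<and> compactin X (X closure_of ((\<lambda>g. \<phi> g x\<^sub>0) ` B))}"

definition bounded_sets :: "('g, 'm) monoid_scheme \<Rightarrow> 'g set \<Rightarrow> 'g set set" where
  "bounded_sets G A =
     {B. B \<subseteq> carrier G \<and> (\<exists>F. finite F \<and> F \<subseteq> carrier G \<and> B \<subseteq> translates G F A)}"

text \<open>
  The type is only meaningful for co-compact pointed locally compact spaces, where the class
  described below exists and is unique; otherwise the value is unspecified.
\<close>

definition gspace_type ::
    "('g, 'm) monoid_scheme \<Rightarrow> 'x topology \<Rightarrow> ('g \<Rightarrow> 'x \<Rightarrow> 'x) \<Rightarrow> 'x \<Rightarrow> 'g set set" where
  "gspace_type G X \<phi> x\<^sub>0 =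
     (THE c. \<exists>A. A \<subseteq> carrier G \<and> A \<noteq> {} \<and>
        rel_compact_sets G X \<phi> x\<^sub>0 = bounded_sets G A \<and> c = approx_class G A)"


section \<open>The Stone--Cech compactification of a discrete group\<close>

text \<open>
  The Stone--Cech compactification of a discrete set \<open>S\<close> is realised as the space of ultrafilters
  on \<open>S\<close>, with the sets of all ultrafilters containing a given \<open>B \<subseteq> S\<close> as basic open sets;
  a point of \<open>S\<close> is identified with the principal ultrafilter at that point.
\<close>

definition ultrafilter_on :: "'a set \<Rightarrow> 'a set set \<Rightarrow> bool" where
  "ultrafilter_on S p \<longleftrightarrow>
     p \<subseteq> Pow S \<and> S \<in> p \<and> {} \<notin> p \<and>
     (\<forall>B\<in>p. \<forall>C\<in>p. B \<inter> C \<in> p) \<and>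
     (\<forall>B\<in>p. \<forall>C. B \<subseteq> C \<and> C \<subseteq> S \<longrightarrow> C \<in> p) \<and>
     (\<forall>B. B \<subseteq> S \<longrightarrow> B \<in> p \<or> S - B \<in> p)"

definition stone_cech :: "'a set \<Rightarrow> 'a set set topology" where
  "stone_cech S =
     topology_generated_by {{p. ultrafilter_on S p \<and> B \<in> p} | B. B \<subseteq> S}"

definition principal_uf :: "'a set \<Rightarrow> 'a \<Rightarrow> 'a set set" where
  "principal_uf S x = {B. B \<subseteq> S \<and> x \<in> B}"

abbreviation beta_group :: "('g, 'm) monoid_scheme \<Rightarrow> 'g set set topology" where
  "beta_group G \<equiv> stone_cech (carrier G)"

text \<open>
  The push-forward of ultrafilters along left multiplication by \<open>g\<close>, i.e. the continuous
  extension of left multiplication.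
\<close>

definition beta_act :: "('g, 'm) monoid_scheme \<Rightarrow> 'g \<Rightarrow> 'g set set \<Rightarrow> 'g set set" where
  "beta_act G g p = (\<lambda>B. g <#\<^bsub>G\<^esub> B) ` p"

definition K_closure :: "('g, 'm) monoid_scheme \<Rightarrow> 'g set \<Rightarrow> 'g set set set" where
  "K_closure G B = beta_group G closure_of (principal_uf (carrier G) ` B)"

definition X_set :: "('g, 'm) monoid_scheme \<Rightarrow> 'g set \<Rightarrow> 'g set set set" where
  "X_set G A = (\<Union>g\<in>carrier G. K_closure G (g <#\<^bsub>G\<^esub> A))"

definition X_space :: "('g, 'm) monoid_scheme \<Rightarrow> 'g set \<Rightarrow> 'g set set topology" where
  "X_space G A = subtopology (beta_group G) (X_set G A)"

definition X_act :: "('g, 'm) monoid_scheme \<Rightarrow> 'g set \<Rightarrow> 'g \<Rightarrow> 'g set set \<Rightarrow> 'g set set" where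
  "X_act G A g = restrict (beta_act G g) (X_set G A)"


lemma topspace_stone_cech: "topspace (stone_cech S) = {p. ultrafilter_on S p}"
  by (auto simp: stone_cech_def topology_generated_by_topspace ultrafilter_on_def)

lemma ultrafilter_principal_uf: "x \<in> S \<Longrightarrow> ultrafilter_on S (principal_uf S x)"
  by (auto simp: ultrafilter_on_def principal_uf_def)

lemma beta_act_principal_uf:
  assumes "group G" "g \<in> carrier G" "x \<in> carrier G"
  shows "beta_act G g (principal_uf (carrier G) x) = principal_uf (carrier G) (g \<otimes>\<^bsub>G\<^esub> x)"
proof -
  interpret group G by fact
  show ?thesis
  proof (intro subset_antisym subsetI)
    fix B assume "B \<in> beta_act G g (principal_uf (carrier G) x)"
    then show "B \<in> principal_uf (carrier G) (g \<otimes>\<^bsub>G\<^esub> x)"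
      using assms by (auto simp: beta_act_def principal_uf_def l_coset_def)
  next
    fix B assume B: "B \<in> principal_uf (carrier G) (g \<otimes>\<^bsub>G\<^esub> x)"
    then have sub: "B \<subseteq> carrier G" and mem: "g \<otimes>\<^bsub>G\<^esub> x \<in> B"
      by (auto simp: principal_uf_def)
    let ?C = "inv\<^bsub>G\<^esub> g <#\<^bsub>G\<^esub> B"
    have "g <#\<^bsub>G\<^esub> ?C = B"
      using lcos_m_assoc[OF sub, of g "inv\<^bsub>G\<^esub> g"] lcos_mult_one[OF sub] assms by simp
    moreover have "x = inv\<^bsub>G\<^esub> g \<otimes>\<^bsub>G\<^esub> (g \<otimes>\<^bsub>G\<^esub> x)"
      using assms by (simp add: m_assoc[symmetric])
    then have "x \<in> ?C"
      using mem unfolding l_coset_def by blast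
    moreover have "?C \<subseteq> carrier G"
      using assms sub by (auto simp: l_coset_def)
    ultimately show "B \<in> beta_act G g (principal_uf (carrier G) x)"
      unfolding beta_act_def principal_uf_def by blast
  qed
qed

end

(*
  For B a subset of G, the closure K_B in the space of ultrafilters is the compact open set of
  all ultrafilters containing B, and the action carries K_B onto K_{gB}.  Hence X_A is open in a
  compact Hausdorff space and is covered by the translates of the compact set K_A.  If the closure
  of B.e in X_A is compact, then finitely many of the open sets K_{gA} cover it; looking at the
  principal ultrafilters of points of B gives B \<subseteq> FA.  Conversely B \<subseteq> FA forces K_B \<subseteq> X_A.
*)
theory Submission
  imports Defs
begin

section \<open>Ultrafilters and the Stone space\<close>

lemma ultrafilter_onD:
  assumes "ultrafilter_on S p"
  shows "p \<subseteq> Pow S" "S \<in> p" "{} \<notin> p"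
    and "B \<in> p \<Longrightarrow> C \<in> p \<Longrightarrow> B \<inter> C \<in> p"
    and "B \<in> p \<Longrightarrow> B \<subseteq> C \<Longrightarrow> C \<subseteq> S \<Longrightarrow> C \<in> p"
    and "B \<subseteq> S \<Longrightarrow> B \<in> p \<or> S - B \<in> p"
  using assms by (simp_all add: ultrafilter_on_def)

lemma ultrafilter_on_Diff_iff:
  assumes "ultrafilter_on S p" "B \<subseteq> S"
  shows "S - B \<in> p \<longleftrightarrow> B \<notin> p"
  using ultrafilter_onD(3)[OF assms(1)] ultrafilter_onD(6)[OF assms]
    ultrafilter_onD(4)[OF assms(1), of B "S - B"] by auto

text \<open>Primeness: if one piece \<open>C\<close> is not in \<open>p\<close>, its complement is,
  and intersecting with the union leaves a member of \<open>p\<close> inside the union of the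
  remaining pieces.\<close>

lemma ultrafilter_on_Union:
  assumes p: "ultrafilter_on S p" and "finite \<B>" "\<B> \<subseteq> Pow S" "\<Union>\<B> \<in> p"
  shows "\<exists>B\<in>\<B>. B \<in> p"
  using assms(2-4)
proof (induction \<B> rule: finite_induct)
  case empty
  then show ?case using ultrafilter_onD(3)[OF p] by simp
next
  case (insert C \<B>)
  show ?case
  proof (cases "C \<in> p")
    case False
    then have "S - C \<in> p"
      using ultrafilter_onD(6)[OF p] insert.prems by blast
    then have "(S - C) \<inter> \<Union>(insert C \<B>) \<in> p"
      using ultrafilter_onD(4)[OF p] insert.prems by blast
    then have "\<Union>\<B> \<in> p"
      by (rule ultrafilter_onD(5)[OF p]) (use insert.prems in auto)
    then show ?thesis using insert by auto
  qed auto
qed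

text \<open>The ultrafilter lemma. Intersecting with \<open>S\<close> gives the empty subfamily its
  proper meaning: \<open>\<Inter>{}\<close> is the universal set, so that case says that
  \<open>S\<close> is non-empty.\<close>

lemma ultrafilter_on_exists:
  assumes "\<A> \<subseteq> Pow S" and fip: "\<And>\<F>. finite \<F> \<Longrightarrow> \<F> \<subseteq> \<A> \<Longrightarrow> S \<inter> \<Inter>\<F> \<noteq> {}"
  shows "\<exists>p. ultrafilter_on S p \<and> \<A> \<subseteq> p"
proof -
  \<comment> \<open>Zorn's lemma is applied to the families containing \<open>\<A>\<close> that have
    the finite intersection property; a maximal one is an ultrafilter.\<close>
  define Z where "Z = {M. \<A> \<subseteq> M \<and> M \<subseteq> Pow S \<and> (\<forall>\<F>. finite \<F> \<and> \<F> \<subseteq> M \<longrightarrow> S \<inter> \<Inter>\<F> \<noteq> {})}"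
  have "\<exists>M\<in>Z. \<forall>X\<in>Z. M \<subseteq> X \<longrightarrow> X = M"
  proof (rule subset_Zorn_nonempty)
    have "\<A> \<in> Z" using assms by (simp add: Z_def)
    then show "Z \<noteq> {}" by blast
  next
    fix \<C> assume ne: "\<C> \<noteq> {}" and ch: "subset.chain Z \<C>"
    have sub: "\<C> \<subseteq> Z" using ch by (simp add: subset_chain_def)
    have "S \<inter> \<Inter>\<F> \<noteq> {}" if fin: "finite \<F>" and \<F>: "\<F> \<subseteq> \<Union>\<C>" for \<F>
    proof -
      obtain M where "M \<in> \<C>" "\<F> \<subseteq> M"
        using finite_subset_Union_chain[OF fin \<F> ne ch] .
      then show ?thesis using sub fin by (auto simp: Z_def)
    qed
    moreover have "\<A> \<subseteq> \<Union>\<C>" "\<Union>\<C> \<subseteq> Pow S"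
      using sub ne unfolding Z_def by blast+
    ultimately show "\<Union>\<C> \<in> Z" by (simp add: Z_def)
  qed
  then obtain M where "M \<in> Z" and max: "\<And>X. X \<in> Z \<Longrightarrow> M \<subseteq> X \<Longrightarrow> X = M" by metis
  then have M: "\<A> \<subseteq> M" "M \<subseteq> Pow S"
    and Mfip: "\<And>\<F>. finite \<F> \<Longrightarrow> \<F> \<subseteq> M \<Longrightarrow> S \<inter> \<Inter>\<F> \<noteq> {}"
    by (simp_all add: Z_def)
  \<comment> \<open>Maximality as a membership test: a set that meets every finite intersection from
    \<open>M\<close> can be adjoined to \<open>M\<close>, hence already belongs to it. The positive
    ultrafilter axioms are all checked with this test.\<close>
  have mem: "C \<in> M" if "C \<subseteq> S" and C: "\<And>\<F>. finite \<F> \<Longrightarrow> \<F> \<subseteq> M \<Longrightarrow> S \<inter> \<Inter>\<F> \<inter> C \<noteq> {}" for C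
  proof -
    have "S \<inter> \<Inter>\<F> \<noteq> {}" if "finite \<F>" "\<F> \<subseteq> insert C M" for \<F>
    proof -
      have "S \<inter> \<Inter>(\<F> - {C}) \<inter> C \<noteq> {}" by (rule C) (use that in auto)
      then show ?thesis by auto
    qed
    then have "insert C M \<in> Z" using M \<open>C \<subseteq> S\<close> by (auto simp: Z_def)
    then have "insert C M = M" by (rule max) auto
    then show ?thesis by auto
  qed
  have "ultrafilter_on S M"
    unfolding ultrafilter_on_def
  proof (intro conjI ballI allI impI)
    show "S \<in> M" using mem[of S] Mfip by blast
    show "{} \<notin> M" using Mfip[of "{{}}"] by auto
  next
    fix B C assume BC: "B \<in> M" "C \<in> M"
    show "B \<inter> C \<in> M"
    proof (rule mem)
      fix \<F> assume "finite \<F>" "\<F> \<subseteq> M"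
      then show "S \<inter> \<Inter>\<F> \<inter> (B \<inter> C) \<noteq> {}"
        using Mfip[of "insert B (insert C \<F>)"] BC by auto
    qed (use BC M in auto)
  next
    fix B C assume BC: "B \<in> M" "B \<subseteq> C \<and> C \<subseteq> S"
    show "C \<in> M"
    proof (rule mem)
      fix \<F> assume "finite \<F>" "\<F> \<subseteq> M"
      then show "S \<inter> \<Inter>\<F> \<inter> C \<noteq> {}"
        using Mfip[of "insert B \<F>"] BC by auto
    qed (use BC in auto)
  next
    fix B assume B: "B \<subseteq> S"
    show "B \<in> M \<or> S - B \<in> M"
    proof (rule disjCI)
      assume "S - B \<notin> M"
      \<comment> \<open>Failure of the test for \<open>S - B\<close> yields a finite intersection
        lying inside \<open>B\<close>. Joined to any further \<open>\<G>\<close>, it gives a point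
        of \<open>B\<close> in the intersection of \<open>\<G>\<close>.\<close>
      then obtain \<F> where \<F>: "finite \<F>" "\<F> \<subseteq> M" "S \<inter> \<Inter>\<F> \<inter> (S - B) = {}"
        using mem[of "S - B"] by auto
      show "B \<in> M"
      proof (rule mem[OF B])
        fix \<G> assume "finite \<G>" "\<G> \<subseteq> M"
        then have "S \<inter> \<Inter>(\<F> \<union> \<G>) \<noteq> {}"
          by (intro Mfip) (use \<F> in auto)
        then obtain x where "x \<in> S" "x \<in> \<Inter>\<F>" "x \<in> \<Inter>\<G>" by auto
        then show "S \<inter> \<Inter>\<G> \<inter> B \<noteq> {}" using \<F>(3) by blast
      qed
    qed
  qed (use M in blast)
  then show ?thesis using M by blast
qed

section \<open>The Stone topology: clopen base, Hausdorff property, compactness, closures\<close>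

text \<open>These are the generating sets of \<open>stone_cech\<close>. They turn out to be clopen
  and to be the closures K_B, so one notation serves both roles.\<close>

definition uf_nbhd :: "'a set \<Rightarrow> 'a set \<Rightarrow> 'a set set set" where
  "uf_nbhd S B = {p. ultrafilter_on S p \<and> B \<in> p}"

lemma uf_nbhd_subset: "uf_nbhd S B \<subseteq> topspace (stone_cech S)"
  by (auto simp: uf_nbhd_def topspace_stone_cech)

lemma uf_nbhd_top: "uf_nbhd S S = topspace (stone_cech S)"
  by (auto simp: uf_nbhd_def topspace_stone_cech ultrafilter_onD)

lemma uf_nbhd_mono: "B \<subseteq> C \<Longrightarrow> C \<subseteq> S \<Longrightarrow> uf_nbhd S B \<subseteq> uf_nbhd S C"
  by (auto simp: uf_nbhd_def intro: ultrafilter_onD(5))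

lemma uf_nbhd_Union:
  assumes "finite \<B>" "\<B> \<subseteq> Pow S"
  shows "uf_nbhd S (\<Union>\<B>) = (\<Union>B\<in>\<B>. uf_nbhd S B)"
proof
  show "uf_nbhd S (\<Union>\<B>) \<subseteq> (\<Union>B\<in>\<B>. uf_nbhd S B)"
    using ultrafilter_on_Union[OF _ assms] by (auto simp: uf_nbhd_def)
  show "(\<Union>B\<in>\<B>. uf_nbhd S B) \<subseteq> uf_nbhd S (\<Union>\<B>)"
    by (intro UN_least uf_nbhd_mono) (use assms in auto)
qed

lemma principal_uf_in_uf_nbhd:
  "x \<in> S \<Longrightarrow> B \<subseteq> S \<Longrightarrow> principal_uf S x \<in> uf_nbhd S B \<longleftrightarrow> x \<in> B"
  by (auto simp: uf_nbhd_def ultrafilter_principal_uf) (auto simp: principal_uf_def)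

lemma openin_uf_nbhd: "B \<subseteq> S \<Longrightarrow> openin (stone_cech S) (uf_nbhd S B)"
  unfolding stone_cech_def uf_nbhd_def by (rule topology_generated_by_Basis) blast

lemma closedin_uf_nbhd:
  assumes "B \<subseteq> S"
  shows "closedin (stone_cech S) (uf_nbhd S B)"
proof -
  have "topspace (stone_cech S) - uf_nbhd S B = uf_nbhd S (S - B)"
    using assms by (auto simp: uf_nbhd_def topspace_stone_cech ultrafilter_on_Diff_iff)
  then show ?thesis
    by (simp add: closedin_def uf_nbhd_subset openin_uf_nbhd)
qed

text \<open>The topology is only given by a subbase. It is a base because the sets
  \<open>uf_nbhd S B\<close> are stable under finite intersection, \<open>B \<inter> C\<close>
  serving for the neighbourhoods of \<open>B\<close> and \<open>C\<close>.\<close>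

lemma stone_cech_base:
  assumes "openin (stone_cech S) U" "p \<in> U"
  shows "\<exists>B\<subseteq>S. p \<in> uf_nbhd S B \<and> uf_nbhd S B \<subseteq> U"
proof -
  have "generate_topology_on {{p. ultrafilter_on S p \<and> B \<in> p} |B. B \<subseteq> S} U"
    using assms(1) unfolding stone_cech_def by (rule openin_topology_generated_by)
  then show ?thesis using assms(2)
  proof (induction U rule: generate_topology_on.induct)
    case (Int U V)
    then obtain B C where "B \<subseteq> S" "p \<in> uf_nbhd S B" "uf_nbhd S B \<subseteq> U"
      and "C \<subseteq> S" "p \<in> uf_nbhd S C" "uf_nbhd S C \<subseteq> V"
      by blast
    moreover have "p \<in> uf_nbhd S (B \<inter> C)"
      using \<open>p \<in> uf_nbhd S B\<close> \<open>p \<in> uf_nbhd S C\<close> by (auto simp: uf_nbhd_def ultrafilter_onD)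
    moreover have "uf_nbhd S (B \<inter> C) \<subseteq> uf_nbhd S B" "uf_nbhd S (B \<inter> C) \<subseteq> uf_nbhd S C"
      using \<open>B \<subseteq> S\<close> \<open>C \<subseteq> S\<close> by (auto intro: uf_nbhd_mono[THEN subsetD])
    ultimately show ?case by (intro exI[of _ "B \<inter> C"]) blast
  next
    case (UN K)
    then show ?case by (meson Union_iff Union_upper subset_trans)
  next
    case (Basis U)
    then show ?case unfolding uf_nbhd_def by blast
  qed simp
qed

lemma Hausdorff_space_stone_cech: "Hausdorff_space (stone_cech S)"
  unfolding Hausdorff_space_def
proof (intro allI impI)
  fix p q assume "p \<in> topspace (stone_cech S) \<and> q \<in> topspace (stone_cech S) \<and> p \<noteq> q"
  then have p: "ultrafilter_on S p" and q: "ultrafilter_on S q" and "p \<noteq> q"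
    by (auto simp: topspace_stone_cech)
  \<comment> \<open>Inclusion between ultrafilters forces equality: a \<open>B\<close> in
    \<open>q\<close> but not in \<open>p\<close> would put \<open>S - B\<close> into
    \<open>p\<close>, hence into \<open>q\<close>. So some set lies in \<open>p\<close> only, and it
    and its complement separate the two points.\<close>
  have "\<not> p \<subseteq> q"
  proof
    assume "p \<subseteq> q"
    moreover have "q \<subseteq> p"
    proof
      fix B assume "B \<in> q"
      then show "B \<in> p"
        using ultrafilter_on_Diff_iff[OF p, of B] ultrafilter_on_Diff_iff[OF q, of B]
          ultrafilter_onD(1)[OF q] \<open>p \<subseteq> q\<close> by blast
    qed
    ultimately show False using \<open>p \<noteq> q\<close> by blast
  qed
  then obtain B where B: "B \<in> p" "B \<notin> q" by blast
  then have "B \<subseteq> S" using ultrafilter_onD(1)[OF p] by blast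
  show "\<exists>U V. openin (stone_cech S) U \<and> openin (stone_cech S) V \<and> p \<in> U \<and> q \<in> V \<and> disjnt U V"
  proof (intro exI conjI)
    show "openin (stone_cech S) (uf_nbhd S B)" "openin (stone_cech S) (uf_nbhd S (S - B))"
      using \<open>B \<subseteq> S\<close> by (auto intro: openin_uf_nbhd)
    show "p \<in> uf_nbhd S B" "q \<in> uf_nbhd S (S - B)"
      using p q B \<open>B \<subseteq> S\<close> by (auto simp: uf_nbhd_def ultrafilter_on_Diff_iff)
    show "disjnt (uf_nbhd S B) (uf_nbhd S (S - B))"
      using \<open>B \<subseteq> S\<close> by (auto simp: disjnt_iff uf_nbhd_def ultrafilter_on_Diff_iff)
  qed
qed

lemma compact_space_stone_cech: "compact_space (stone_cech S)"
  unfolding compact_space_def compactin_def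
proof (intro conjI allI impI)
  fix \<U> assume "Ball \<U> (openin (stone_cech S)) \<and> topspace (stone_cech S) \<subseteq> \<Union>\<U>"
  then have op: "\<And>U. U \<in> \<U> \<Longrightarrow> openin (stone_cech S) U" and cov: "topspace (stone_cech S) \<subseteq> \<Union>\<U>"
    by auto
  \<comment> \<open>\<open>W\<close> collects the index sets of basic sets inside a single cover
    member. Finitely many of them covering \<open>S\<close> are enough, since \<open>uf_nbhd\<close>
    commutes with finite unions.\<close>
  define W where "W = {B. B \<subseteq> S \<and> (\<exists>U\<in>\<U>. uf_nbhd S B \<subseteq> U)}"
  have "\<exists>\<B>. finite \<B> \<and> \<B> \<subseteq> W \<and> S \<subseteq> \<Union>\<B>"
  proof (rule ccontr)
    assume no: "\<not> ?thesis"
    \<comment> \<open>If no finite part of \<open>W\<close> covers \<open>S\<close>, the complements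
      have the finite intersection property. An ultrafilter containing all of them lies in some
      cover member, hence contains some \<open>B\<close> in \<open>W\<close> together with
      \<open>S - B\<close>.\<close>
    have "\<exists>p. ultrafilter_on S p \<and> (\<lambda>B. S - B) ` W \<subseteq> p"
    proof (rule ultrafilter_on_exists)
      fix \<F> assume "finite \<F>" "\<F> \<subseteq> (\<lambda>B. S - B) ` W"
      then obtain \<B> where "\<B> \<subseteq> W" "finite \<B>" "\<F> = (\<lambda>B. S - B) ` \<B>"
        by (meson finite_subset_image)
      then show "S \<inter> \<Inter>\<F> \<noteq> {}" using no by auto
    qed auto
    then obtain p where p: "ultrafilter_on S p" and W: "\<And>B. B \<in> W \<Longrightarrow> S - B \<in> p" by blast
    obtain U where "U \<in> \<U>" "p \<in> U" using cov p by (auto simp: topspace_stone_cech)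
    then obtain B where B: "B \<subseteq> S" "p \<in> uf_nbhd S B" "uf_nbhd S B \<subseteq> U"
      using stone_cech_base[OF op[OF \<open>U \<in> \<U>\<close>] \<open>p \<in> U\<close>] by auto
    then have "B \<in> W" using \<open>U \<in> \<U>\<close> by (auto simp: W_def)
    then show False
      using W B ultrafilter_on_Diff_iff[OF p] by (auto simp: uf_nbhd_def)
  qed
  then obtain \<B> where \<B>: "finite \<B>" "\<B> \<subseteq> W" "S \<subseteq> \<Union>\<B>" by blast
  have "\<forall>B\<in>\<B>. \<exists>U. U \<in> \<U> \<and> uf_nbhd S B \<subseteq> U" using \<B> by (auto simp: W_def)
  then obtain u where u: "\<And>B. B \<in> \<B> \<Longrightarrow> u B \<in> \<U> \<and> uf_nbhd S B \<subseteq> u B" by metis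
  have "\<B> \<subseteq> Pow S" "\<Union>\<B> = S" using \<B> by (auto simp: W_def)
  then have "topspace (stone_cech S) \<subseteq> (\<Union>B\<in>\<B>. uf_nbhd S B)"
    using uf_nbhd_Union[OF \<B>(1), of S] by (simp add: uf_nbhd_top)
  then have "topspace (stone_cech S) \<subseteq> \<Union>(u ` \<B>)" using u by blast
  then show "\<exists>\<F>. finite \<F> \<and> \<F> \<subseteq> \<U> \<and> topspace (stone_cech S) \<subseteq> \<Union>\<F>"
    using \<B>(1) u by (intro exI[of _ "u ` \<B>"]) auto
qed simp

lemma compactin_uf_nbhd: "B \<subseteq> S \<Longrightarrow> compactin (stone_cech S) (uf_nbhd S B)"
  by (simp add: closedin_compact_space closedin_uf_nbhd compact_space_stone_cech)

text \<open>The right side is closed and contains the principal ultrafilters of \<open>B\<close>.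
  Conversely, if \<open>p\<close> contains \<open>B\<close> and lies in a basic set given by
  \<open>C\<close>, then \<open>B \<inter> C\<close> is in \<open>p\<close>, hence non-empty, and
  any of its points gives a principal ultrafilter in that basic set.\<close>

lemma closure_of_principal_uf:
  assumes "B \<subseteq> S"
  shows "stone_cech S closure_of (principal_uf S ` B) = uf_nbhd S B"
proof
  show "stone_cech S closure_of (principal_uf S ` B) \<subseteq> uf_nbhd S B"
    using assms by (intro closure_of_minimal closedin_uf_nbhd image_subsetI)
      (auto simp: principal_uf_in_uf_nbhd subsetD)
  show "uf_nbhd S B \<subseteq> stone_cech S closure_of (principal_uf S ` B)"
  proof
    fix p assume p: "p \<in> uf_nbhd S B"
    have "\<exists>y. y \<in> principal_uf S ` B \<and> y \<in> U" if U: "p \<in> U" "openin (stone_cech S) U" for U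
    proof -
      obtain C where C: "C \<subseteq> S" "p \<in> uf_nbhd S C" "uf_nbhd S C \<subseteq> U"
        using stone_cech_base[OF U(2,1)] by auto
      then have "B \<inter> C \<in> p" "{} \<notin> p"
        using p by (auto simp: uf_nbhd_def ultrafilter_onD)
      then have "B \<inter> C \<noteq> {}" by metis
      then obtain x where "x \<in> B" "x \<in> C" by blast
      then show ?thesis using C principal_uf_in_uf_nbhd[of x S C] by blast
    qed
    then show "p \<in> stone_cech S closure_of (principal_uf S ` B)"
      using p uf_nbhd_subset by (auto simp: in_closure_of)
  qed
qed

section \<open>Transport of ultrafilters along bijections\<close>

text \<open>Ultrafilters are pushed forward by direct images of their members, as in
  \<open>beta_act\<close>. Injectivity ensures that an image set comes from only one subset of
  \<open>S\<close>.\<close>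

lemma image_mem_image_image:
  assumes "inj_on f S" "p \<subseteq> Pow S" "B \<subseteq> S"
  shows "f ` B \<in> (`) f ` p \<longleftrightarrow> B \<in> p"
  using assms by (auto simp: inj_on_image_eq_iff image_iff)

text \<open>A bijection identifies the power sets of \<open>S\<close> and \<open>T\<close> as
  Boolean algebras: surjectivity makes every subset of \<open>T\<close> an image, and injectivity
  preserves intersections, complements and inclusion in both directions.\<close>

lemma ultrafilter_on_image:
  assumes bij: "bij_betw f S T" and p: "ultrafilter_on S p"
  shows "ultrafilter_on T ((`) f ` p)"
proof -
  have inj: "inj_on f S" and im: "f ` S = T" using bij by (auto simp: bij_betw_def)
  note mem = image_mem_image_image[OF inj ultrafilter_onD(1)[OF p]]
  have sub: "B \<subseteq> S" if "B \<in> p" for B using that ultrafilter_onD(1)[OF p] by blast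
  show ?thesis
    unfolding ultrafilter_on_def
  proof (intro conjI ballI allI impI)
    show "(`) f ` p \<subseteq> Pow T" using sub im by blast
    show "T \<in> (`) f ` p" using mem[of S] im ultrafilter_onD(2)[OF p] by simp
    show "{} \<notin> (`) f ` p" using ultrafilter_onD(3)[OF p] by auto
  next
    fix B C assume "B \<in> (`) f ` p" "C \<in> (`) f ` p"
    then obtain B' C' where "B' \<in> p" "C' \<in> p" "B = f ` B'" "C = f ` C'" by blast
    then show "B \<inter> C \<in> (`) f ` p"
      using ultrafilter_onD(4)[OF p] sub inj_on_image_Int[OF inj, of B' C', symmetric] by auto
  next
    fix B C assume B: "B \<in> (`) f ` p" and C: "B \<subseteq> C \<and> C \<subseteq> T"
    obtain B' where B': "B' \<in> p" "B = f ` B'" using B by blast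
    obtain C' where C': "C' \<subseteq> S" "C = f ` C'" using C im by (meson subset_imageE)
    have "B' \<subseteq> C'"
    proof
      fix x assume "x \<in> B'"
      then have "x \<in> S" "f x \<in> f ` C'" using sub B' C' C by auto
      then show "x \<in> C'" using inj_on_image_mem_iff[OF inj _ C'(1)] by blast
    qed
    then show "C \<in> (`) f ` p" using ultrafilter_onD(5)[OF p B'(1)] C' by blast
  next
    fix B assume "B \<subseteq> T"
    then obtain B' where B': "B' \<subseteq> S" "B = f ` B'" using im by (meson subset_imageE)
    then have "T - B = f ` (S - B')" using im inj by (simp add: inj_on_image_set_diff[OF inj])
    then show "B \<in> (`) f ` p \<or> T - B \<in> (`) f ` p"
      using ultrafilter_onD(6)[OF p] B' by blast
  qed
qed

text \<open>Continuity is checked on the generating sets: the preimage of the one given by the image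
  of \<open>B\<close> is \<open>uf_nbhd S B\<close>.\<close>

lemma continuous_map_stone_cech_image:
  assumes bij: "bij_betw f S T"
  shows "continuous_map (stone_cech S) (stone_cech T) (\<lambda>p. (`) f ` p)"
  unfolding stone_cech_def[of T]
proof (rule continuous_on_generated_topo)
  have inj: "inj_on f S" and im: "f ` S = T" using bij by (auto simp: bij_betw_def)
  fix U assume "U \<in> {{p. ultrafilter_on T p \<and> B \<in> p} |B. B \<subseteq> T}"
  then obtain C where "C \<subseteq> T" and U: "U = {p. ultrafilter_on T p \<and> C \<in> p}" by blast
  then obtain B where B: "B \<subseteq> S" "C = f ` B" using im by (meson subset_imageE)
  have "ultrafilter_on T ((`) f ` p) \<and> C \<in> (`) f ` p \<longleftrightarrow> B \<in> p" if "ultrafilter_on S p" for p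
    using image_mem_image_image[OF inj ultrafilter_onD(1)[OF that] B(1)]
      ultrafilter_on_image[OF bij that] B(2) by simp
  then have "(\<lambda>p. (`) f ` p) -` U \<inter> topspace (stone_cech S) = uf_nbhd S B"
    by (auto simp: U topspace_stone_cech uf_nbhd_def)
  then show "openin (stone_cech S) ((\<lambda>p. (`) f ` p) -` U \<inter> topspace (stone_cech S))"
    using openin_uf_nbhd[OF B(1)] by simp
next
  show "(\<lambda>p. (`) f ` p) ` topspace (stone_cech S) \<subseteq> \<Union>{{p. ultrafilter_on T p \<and> B \<in> p} |B. B \<subseteq> T}"
    \<comment> \<open>The unfolded fact says that the union of the generating sets is the set of all
      ultrafilters on \<open>T\<close>.\<close>
    unfolding topspace_stone_cech[of T, unfolded stone_cech_def topology_generated_by_topspace]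
    by (auto simp: topspace_stone_cech ultrafilter_on_image[OF bij])
qed

section \<open>The action on ultrafilters\<close>

context group
begin

section \<open>Left multiplication on ultrafilters\<close>

lemma l_coset_eq_image: "g <# B = (\<lambda>x. g \<otimes> x) ` B"
  by (auto simp: l_coset_def)

lemma bij_betw_l_mult:
  assumes "g \<in> carrier G"
  shows "bij_betw (\<lambda>x. g \<otimes> x) (carrier G) (carrier G)"
  by (rule bij_betwI[where g = "\<lambda>x. inv g \<otimes> x"]) (use assms in \<open>auto simp: m_assoc[symmetric]\<close>)

text \<open>Identifies the action with the push-forward along left multiplication, so that the
  transport results for bijections apply.\<close>

lemma beta_act_eq_image: "beta_act G g = (\<lambda>p. (`) ((\<otimes>) g) ` p)"
  by (simp add: beta_act_def l_coset_eq_image fun_eq_iff)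

lemma continuous_map_beta_act:
  "g \<in> carrier G \<Longrightarrow> continuous_map (beta_group G) (beta_group G) (beta_act G g)"
  unfolding beta_act_eq_image by (intro continuous_map_stone_cech_image bij_betw_l_mult)

text \<open>The coset identity holds for subsets of the carrier; that \<open>p\<close> is an
  ultrafilter on the carrier guarantees this for its members.\<close>

lemma beta_act_mult:
  assumes "ultrafilter_on (carrier G) p" "g \<in> carrier G" "h \<in> carrier G"
  shows "beta_act G g (beta_act G h p) = beta_act G (g \<otimes> h) p"
  unfolding beta_act_def image_image
proof (rule image_cong)
  show "g <# (h <# B) = (g \<otimes> h) <# B" if "B \<in> p" for B
    using assms that ultrafilter_onD(1)[OF assms(1)] by (intro lcos_m_assoc) auto
qed simp

lemma beta_act_one:
  assumes "ultrafilter_on (carrier G) p"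
  shows "beta_act G \<one> p = p"
proof -
  have "\<one> <# B = B" if "B \<in> p" for B
    using lcos_mult_one that ultrafilter_onD(1)[OF assms] by blast
  then show ?thesis by (simp add: beta_act_def)
qed

lemma beta_act_in_uf_nbhd:
  assumes "g \<in> carrier G" "B \<subseteq> carrier G" "p \<in> uf_nbhd (carrier G) B"
  shows "beta_act G g p \<in> uf_nbhd (carrier G) (g <# B)"
  using assms ultrafilter_on_image[OF bij_betw_l_mult]
  by (auto simp: uf_nbhd_def beta_act_eq_image l_coset_eq_image)

text \<open>For the reverse inclusion, the preimage of \<open>p\<close> is its translate by
  \<open>inv g\<close>.\<close>

lemma beta_act_image_uf_nbhd:
  assumes g: "g \<in> carrier G" and B: "B \<subseteq> carrier G"
  shows "beta_act G g ` uf_nbhd (carrier G) B = uf_nbhd (carrier G) (g <# B)"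
proof
  show "beta_act G g ` uf_nbhd (carrier G) B \<subseteq> uf_nbhd (carrier G) (g <# B)"
    using beta_act_in_uf_nbhd assms by blast
  show "uf_nbhd (carrier G) (g <# B) \<subseteq> beta_act G g ` uf_nbhd (carrier G) B"
  proof
    fix p assume p: "p \<in> uf_nbhd (carrier G) (g <# B)"
    have "inv g <# (g <# B) = B"
      using g B by (simp add: lcos_m_assoc lcos_mult_one)
    then have "beta_act G (inv g) p \<in> uf_nbhd (carrier G) B"
      using beta_act_in_uf_nbhd[of "inv g" "g <# B" p] g B p l_coset_subset_G by force
    moreover have "ultrafilter_on (carrier G) p" using p by (simp add: uf_nbhd_def)
    then have "beta_act G g (beta_act G (inv g) p) = p"
      using g by (simp add: beta_act_mult beta_act_one)
    ultimately show "p \<in> beta_act G g ` uf_nbhd (carrier G) B" by force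
  qed
qed

lemma K_closure_eq: "B \<subseteq> carrier G \<Longrightarrow> K_closure G B = uf_nbhd (carrier G) B"
  by (simp add: K_closure_def closure_of_principal_uf)

section \<open>The open subspace X_A and its G-action\<close>

lemma X_set_eq:
  assumes "A \<subseteq> carrier G"
  shows "X_set G A = (\<Union>g\<in>carrier G. uf_nbhd (carrier G) (g <# A))"
  using assms unfolding X_set_def by (simp add: K_closure_eq l_coset_subset_G)

lemma X_set_subset:
  assumes "A \<subseteq> carrier G"
  shows "X_set G A \<subseteq> topspace (beta_group G)"
  using uf_nbhd_subset unfolding X_set_eq[OF assms] by blast

lemma X_set_ultrafilter:
  "A \<subseteq> carrier G \<Longrightarrow> p \<in> X_set G A \<Longrightarrow> ultrafilter_on (carrier G) p"
  using X_set_subset by (auto simp: topspace_stone_cech)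

lemma openin_X_set:
  assumes "A \<subseteq> carrier G"
  shows "openin (beta_group G) (X_set G A)"
  unfolding X_set_eq[OF assms]
  by (rule openin_Union) (auto simp: openin_uf_nbhd l_coset_subset_G[OF assms])

lemma topspace_X_space: "A \<subseteq> carrier G \<Longrightarrow> topspace (X_space G A) = X_set G A"
  using X_set_subset by (auto simp: X_space_def)

lemma principal_uf_in_X_set:
  assumes "A \<subseteq> carrier G" "A \<noteq> {}" "x \<in> carrier G"
  shows "principal_uf (carrier G) x \<in> X_set G A"
proof -
  obtain a where a: "a \<in> A" "a \<in> carrier G" using assms by blast
  \<comment> \<open>Any point \<open>a\<close> of \<open>A\<close> can be moved to \<open>x\<close>,
    so the translates of a non-empty \<open>A\<close> cover the group.\<close>
  have "(x \<otimes> inv a) \<otimes> a = x" using a assms by (simp add: m_assoc)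
  then have "x \<in> (x \<otimes> inv a) <# A" using a unfolding l_coset_def by force
  then show ?thesis
    using a assms principal_uf_in_uf_nbhd[of x "carrier G" "(x \<otimes> inv a) <# A"]
    by (auto simp: X_set_eq l_coset_subset_G)
qed

lemma beta_act_in_X_set:
  assumes "A \<subseteq> carrier G" "g \<in> carrier G" "p \<in> X_set G A"
  shows "beta_act G g p \<in> X_set G A"
proof -
  obtain h where h: "h \<in> carrier G" "p \<in> uf_nbhd (carrier G) (h <# A)"
    using assms by (auto simp: X_set_eq)
  then have "beta_act G g p \<in> uf_nbhd (carrier G) ((g \<otimes> h) <# A)"
    using beta_act_in_uf_nbhd[of g "h <# A" p] assms by (simp add: lcos_m_assoc l_coset_subset_G)
  then show ?thesis using assms h by (auto simp: X_set_eq)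
qed

text \<open>The orbit map of the base point is the embedding of the group into its compactification;
  this turns B.e into the set of principal ultrafilters of \<open>B\<close>.\<close>

lemma X_act_principal_uf:
  assumes "A \<subseteq> carrier G" "A \<noteq> {}" "g \<in> carrier G"
  shows "X_act G A g (principal_uf (carrier G) \<one>) = principal_uf (carrier G) g"
  using assms principal_uf_in_X_set[of A \<one>] beta_act_principal_uf[of G g \<one>] is_group
  by (simp add: X_act_def)

lemma X_act_inverse:
  assumes "A \<subseteq> carrier G" "g \<in> carrier G" "p \<in> X_set G A"
  shows "X_act G A (inv g) (X_act G A g p) = p"
  using assms by (simp add: X_act_def beta_act_in_X_set beta_act_mult beta_act_one X_set_ultrafilter)

lemma continuous_map_X_act:
  assumes "A \<subseteq> carrier G" "g \<in> carrier G"
  shows "continuous_map (X_space G A) (X_space G A) (X_act G A g)"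
\<comment> \<open>Continuity is proved for the unrestricted \<open>beta_act G g\<close>, which
  agrees with \<open>X_act G A g\<close> on the space.\<close>
proof (rule continuous_map_eq)
  show "continuous_map (X_space G A) (X_space G A) (beta_act G g)"
    unfolding X_space_def
    using assms beta_act_in_X_set
    by (intro continuous_map_into_subtopology continuous_map_from_subtopology continuous_map_beta_act)
      auto
qed (use assms in \<open>auto simp: topspace_X_space X_act_def\<close>)

lemma homeomorphic_map_X_act:
  assumes "A \<subseteq> carrier G" "g \<in> carrier G"
  shows "homeomorphic_map (X_space G A) (X_space G A) (X_act G A g)"
proof -
  have "homeomorphic_maps (X_space G A) (X_space G A) (X_act G A g) (X_act G A (inv g))"
    using assms X_act_inverse[of A g] X_act_inverse[of A "inv g"]
    by (simp add: homeomorphic_maps_def continuous_map_X_act topspace_X_space)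
  then show ?thesis by (simp add: homeomorphic_maps_map)
qed

lemma group_action_X_act:
  assumes A: "A \<subseteq> carrier G"
  shows "group_action G (X_set G A) (X_act G A)"
proof -
  have Bij: "X_act G A g \<in> Bij (X_set G A)" if "g \<in> carrier G" for g
    using homeomorphic_map_X_act[OF A that] A
    by (simp add: Bij_def bij_betw_def homeomorphic_eq_everything_map topspace_X_space X_act_def)
  \<comment> \<open>This is an equality of total functions: on X_A it is the action law, and outside
    both sides are \<open>undefined\<close>.\<close>
  have "X_act G A (g \<otimes> h) = compose (X_set G A) (X_act G A g) (X_act G A h)"
    if "g \<in> carrier G" "h \<in> carrier G" for g h
    using that A
    by (auto simp: fun_eq_iff compose_def X_act_def restrict_def beta_act_mult X_set_ultrafilter
        beta_act_in_X_set)
  then have "X_act G A \<in> hom G (BijGroup (X_set G A))"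
    using Bij by (auto simp: hom_def BijGroup_def)
  then show ?thesis
    by (intro group_action.intro group_hom.intro group_hom_axioms.intro is_group group_BijGroup)
qed

text \<open>Closure in a subspace is the trace of the closure in the whole space. Boundedness of
  \<open>B\<close> will be decided by whether this trace of K_B is compact.\<close>

lemma closure_of_X_space_principal_uf:
  assumes "A \<subseteq> carrier G" "A \<noteq> {}" "B \<subseteq> carrier G"
  shows "X_space G A closure_of (principal_uf (carrier G) ` B) = X_set G A \<inter> uf_nbhd (carrier G) B"
proof -
  have "principal_uf (carrier G) ` B \<subseteq> X_set G A"
    using assms by (auto intro!: principal_uf_in_X_set)
  then show ?thesis
    unfolding X_space_def
    using assms by (simp add: closure_of_subtopology closure_of_principal_uf Int_absorb1)
qed

text \<open>Local compactness comes from being open in a compact Hausdorff space. The orbit of the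
  base point consists of all principal ultrafilters, whose closure is the whole compactification, so
  it is dense in X_A.\<close>

lemma pointed_lc_gspace_X_space:
  assumes "A \<subseteq> carrier G" "A \<noteq> {}"
  shows "pointed_lc_gspace G (X_space G A) (X_act G A) (principal_uf (carrier G) \<one>)"
proof -
  have "orbit G (X_act G A) (principal_uf (carrier G) \<one>) = principal_uf (carrier G) ` carrier G"
    unfolding orbit_def by (force simp: X_act_principal_uf[OF assms])
  then have "X_space G A closure_of orbit G (X_act G A) (principal_uf (carrier G) \<one>)
      = topspace (X_space G A)"
    using assms X_set_subset[of A]
    by (auto simp: closure_of_X_space_principal_uf uf_nbhd_top topspace_X_space)
  moreover have "locally_compact_space (X_space G A)"
    unfolding X_space_def
    using assms by (intro locally_compact_space_open_subset compact_imp_locally_compact_space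
        compact_space_stone_cech openin_X_set) (auto simp: Hausdorff_space_stone_cech)
  moreover have "Hausdorff_space (X_space G A)"
    unfolding X_space_def by (intro Hausdorff_space_subtopology Hausdorff_space_stone_cech)
  ultimately show ?thesis
    using assms unfolding pointed_lc_gspace_def
    by (simp add: topspace_X_space group_action_X_act homeomorphic_map_X_act principal_uf_in_X_set)
qed

lemma uf_nbhd_subset_X_set:
  assumes "A \<subseteq> carrier G" "g \<in> carrier G"
  shows "uf_nbhd (carrier G) (g <# A) \<subseteq> X_set G A"
  using assms by (auto simp: X_set_eq)

lemma cocompact_gspace_X_space:
  assumes A: "A \<subseteq> carrier G"
  shows "cocompact_gspace G (X_space G A) (X_act G A)"
  unfolding cocompact_gspace_def
proof (intro exI conjI)
  \<comment> \<open>The compact set is K_A, which lies in X_A as the translate by the neutral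
    element.\<close>
  have sub: "uf_nbhd (carrier G) A \<subseteq> X_set G A"
    using uf_nbhd_subset_X_set[OF A one_closed] A by (simp add: lcos_mult_one)
  then show "compactin (X_space G A) (uf_nbhd (carrier G) A)"
    using A by (simp add: X_space_def compactin_subtopology compactin_uf_nbhd)
  have "X_act G A g ` uf_nbhd (carrier G) A = uf_nbhd (carrier G) (g <# A)" if "g \<in> carrier G" for g
    using sub beta_act_image_uf_nbhd[OF that A] by (auto simp: X_act_def image_def subset_iff)
  then show "(\<Union>g\<in>carrier G. X_act G A g ` uf_nbhd (carrier G) A) = topspace (X_space G A)"
    using A by (simp add: topspace_X_space X_set_eq)
qed

section \<open>The type\<close>

lemma rel_compact_sets_X_space:
  assumes A: "A \<subseteq> carrier G" and ne: "A \<noteq> {}"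
  shows "rel_compact_sets G (X_space G A) (X_act G A) (principal_uf (carrier G) \<one>) = bounded_sets G A"
proof -
  have "compactin (X_space G A) (X_set G A \<inter> uf_nbhd (carrier G) B)
      \<longleftrightarrow> (\<exists>F. finite F \<and> F \<subseteq> carrier G \<and> B \<subseteq> translates G F A)" (is "?L \<longleftrightarrow> ?R")
    if B: "B \<subseteq> carrier G" for B
  proof
    assume ?L
    then have "compactin (beta_group G) (X_set G A \<inter> uf_nbhd (carrier G) B)"
      by (simp add: X_space_def compactin_subtopology)
    moreover have "\<forall>U\<in>(\<lambda>g. uf_nbhd (carrier G) (g <# A)) ` carrier G. openin (beta_group G) U"
      using A l_coset_subset_G by (simp add: openin_uf_nbhd)
    moreover have "X_set G A \<inter> uf_nbhd (carrier G) B
        \<subseteq> \<Union>((\<lambda>g. uf_nbhd (carrier G) (g <# A)) ` carrier G)"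
      using A by (auto simp: X_set_eq)
    ultimately obtain \<F> where "finite \<F>" "\<F> \<subseteq> (\<lambda>g. uf_nbhd (carrier G) (g <# A)) ` carrier G"
      and cov: "X_set G A \<inter> uf_nbhd (carrier G) B \<subseteq> \<Union>\<F>"
      unfolding compactin_def by meson
    then obtain F where F: "finite F" "F \<subseteq> carrier G"
      and \<F>: "\<F> = (\<lambda>g. uf_nbhd (carrier G) (g <# A)) ` F"
      by (meson finite_subset_image)
    have "b \<in> translates G F A" if "b \<in> B" for b
    proof -
      \<comment> \<open>The principal ultrafilter at \<open>b\<close> lies in the trace of K_B,
        hence in one of the selected sets K_{gA}; for a principal ultrafilter this means that
        \<open>b\<close> is in gA.\<close>
      have b: "b \<in> carrier G" using B that by blast
      then have "principal_uf (carrier G) b \<in> \<Union>\<F>"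
        using cov principal_uf_in_X_set[OF A ne] principal_uf_in_uf_nbhd[OF b B] that by blast
      then obtain g where "g \<in> F" "principal_uf (carrier G) b \<in> uf_nbhd (carrier G) (g <# A)"
        using \<F> by auto
      then have "b \<in> g <# A"
        using principal_uf_in_uf_nbhd[OF b, of "g <# A"] l_coset_subset_G[OF A] F(2) by auto
      then show ?thesis using \<open>g \<in> F\<close> by (auto simp: translates_def)
    qed
    then show ?R using F by blast
  next
    assume ?R
    then obtain F where F: "finite F" "F \<subseteq> carrier G" "B \<subseteq> translates G F A" by blast
    have sub: "(\<lambda>g. g <# A) ` F \<subseteq> Pow (carrier G)"
      using F A l_coset_subset_G by blast
    \<comment> \<open>As \<open>F\<close> is finite, the neighbourhood of the union of the
      translates is the union of their neighbourhoods, all inside X_A. Thus the trace of K_B is K_B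
      itself, which is compact.\<close>
    have "uf_nbhd (carrier G) B \<subseteq> uf_nbhd (carrier G) (\<Union>((\<lambda>g. g <# A) ` F))"
      using F(3) sub unfolding translates_def by (intro uf_nbhd_mono) auto
    also have "\<dots> \<subseteq> X_set G A"
      using uf_nbhd_Union[OF finite_imageI[OF F(1)] sub] uf_nbhd_subset_X_set[OF A] F(2) by auto
    finally show ?L
      using B by (simp add: X_space_def compactin_subtopology Int_absorb1 compactin_uf_nbhd)
  qed
  moreover have "(\<lambda>g. X_act G A g (principal_uf (carrier G) \<one>)) ` B = principal_uf (carrier G) ` B"
    if "B \<subseteq> carrier G" for B
    using that by (intro image_cong) (auto simp: X_act_principal_uf[OF A ne])
  ultimately show ?thesis
    unfolding rel_compact_sets_def bounded_sets_def
    by (auto simp: closure_of_X_space_principal_uf[OF A ne])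
qed

section \<open>The comparison preorder and uniqueness of the class\<close>

lemma set_propto_refl: "A \<subseteq> carrier G \<Longrightarrow> set_propto G A A"
  unfolding set_propto_def translates_def
  by (intro exI[of _ "{\<one>}"]) (auto simp: lcos_mult_one)

lemma set_propto_trans:
  assumes "C \<subseteq> carrier G" "set_propto G A B" "set_propto G B C"
  shows "set_propto G A C"
proof -
  obtain E F where E: "finite E" "E \<subseteq> carrier G" "A \<subseteq> translates G E B"
    and F: "finite F" "F \<subseteq> carrier G" "B \<subseteq> translates G F C"
    using assms unfolding set_propto_def by blast
  \<comment> \<open>The two finite sets of translations compose to their product set.\<close>
  let ?H = "(\<lambda>(g, h). g \<otimes> h) ` (E \<times> F)"
  have "A \<subseteq> translates G ?H C"
  proof
    fix a assume "a \<in> A"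
    then obtain g b where g: "g \<in> E" "b \<in> B" "a = g \<otimes> b"
      using E by (auto simp: translates_def l_coset_def)
    then obtain h c where h: "h \<in> F" "c \<in> C" "b = h \<otimes> c"
      using F by (auto simp: translates_def l_coset_def)
    have "a = (g \<otimes> h) \<otimes> c" using g h E F assms by (simp add: m_assoc subset_iff)
    then show "a \<in> translates G ?H C" using g h by (force simp: translates_def l_coset_def)
  qed
  moreover have "finite ?H" "?H \<subseteq> carrier G" using E F by auto
  ultimately show ?thesis unfolding set_propto_def by blast
qed

text \<open>\<open>bounded_sets G A\<close> is the down-set of \<open>A\<close> for
  \<open>set_propto\<close>. Equal down-sets contain each other's generators by reflexivity, and
  transitivity then identifies the classes.\<close>

lemma approx_class_eqI:
  assumes "A \<subseteq> carrier G" "B \<subseteq> carrier G" "bounded_sets G A = bounded_sets G B"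
  shows "approx_class G A = approx_class G B"
proof -
  have "bounded_sets G C = {D. D \<subseteq> carrier G \<and> set_propto G D C}" for C
    by (simp add: bounded_sets_def set_propto_def)
  then have "set_propto G A B" "set_propto G B A"
    using assms set_propto_refl by blast+
  then show ?thesis
    using assms(1,2) set_propto_trans unfolding approx_class_def set_approx_def by blast
qed

text \<open>Discharges the definite description: \<open>A\<close> itself witnesses existence, and
  any other admissible set has the same bounded sets, hence the same class.\<close>

lemma gspace_type_eq:
  assumes "A \<subseteq> carrier G" "A \<noteq> {}" "rel_compact_sets G X \<phi> x\<^sub>0 = bounded_sets G A"
  shows "gspace_type G X \<phi> x\<^sub>0 = approx_class G A"
  unfolding gspace_type_def
proof (rule the_equality)
  show "\<exists>B. B \<subseteq> carrier G \<and> B \<noteq> {} \<and> rel_compact_sets G X \<phi> x\<^sub>0 = bounded_sets G B \<and>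
      approx_class G A = approx_class G B"
    using assms by blast
next
  fix c
  assume "\<exists>B. B \<subseteq> carrier G \<and> B \<noteq> {} \<and> rel_compact_sets G X \<phi> x\<^sub>0 = bounded_sets G B \<and>
      c = approx_class G B"
  then show "c = approx_class G A"
    using assms approx_class_eqI by metis
qed

end

theorem proposition3p12:
  fixes G :: "('g, 'm) monoid_scheme" and A :: "'g set"
  assumes "group G" and "A \<subseteq> carrier G" and "A \<noteq> {}"
  shows "pointed_lc_gspace G (X_space G A) (X_act G A) (principal_uf (carrier G) \<one>\<^bsub>G\<^esub>) \<and>
         cocompact_gspace G (X_space G A) (X_act G A) \<and>
         gspace_type G (X_space G A) (X_act G A) (principal_uf (carrier G) \<one>\<^bsub>G\<^esub>)
           = approx_class G A"
proof -
  interpret group G by fact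
  show ?thesis
    using assms(2,3)
    by (simp add: pointed_lc_gspace_X_space cocompact_gspace_X_space gspace_type_eq
        rel_compact_sets_X_space)
qed

end
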